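(* The set $\mathcal{L}(3)$ contains infinitely many (pairwise non-isomorphic) irreducible critically $3$-frustrated signed graphs; i.e. $\mathcal{L}(3)$ is infinite.
   Context: A signed graph $(G,\sigma)$ is a finite graph $G$ (loops and multiple edges allowed) with $\sigma:E(G)\to\{+,-\}$. Switching at a vertex $v$ multiplies the signs of all edges at $v$ by $-$. The frustration index $\ell(G,\sigma)$ is the minimum number of negative edges over all signatures obtained from $\sigma$ by switchings. $(G,\sigma)$ is critically $k$-frustrated if $\ell(G,\sigma)=k$ and $\ell(G-e,\sigma)=k-1$ for every edge $e$. A $t$-multiedge $E_{xy}$ is a set of $t$ parallel edges joining distinct vertices $x,y$, all of the same sign. Subdividing at $E_{xy}$: delete $E_{xy}$, add a new vertex $w$, a $t$-multiedge $E_{xw}$ with the sign of $E_{xy}$ and an all-positive $t$-multiedge $E_{wy}$. A subdivision is obtained by a sequence of such operations; a signed graph is irreducible if it is not a proper subdivision of any signed graph. $\mathcal{L}(k)$ is the family of irreducible critically $k$-frustrated signed graphs. *)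

theory Defs
  imports Main
begin

datatype edge_sign = Positive | Negative

fun flip_sign :: "edge_sign \<Rightarrow> edge_sign" where
  "flip_sign Positive = Negative"
| "flip_sign Negative = Positive"

text \<open>Edges are abstract names, so parallel edges are possible; \<open>ends G e\<close> is the set of end vertices
  of \<open>e\<close>, a singleton when \<open>e\<close> is a loop. The values of \<open>ends\<close> and \<open>signature\<close> outside of \<open>edges G\<close>
  carry no meaning.\<close>

record ('v, 'e) sgraph =
  verts :: "'v set"
  edges :: "'e set"
  ends :: "'e \<Rightarrow> 'v set"
  signature :: "'e \<Rightarrow> edge_sign"

definition signed_graph :: "('v, 'e) sgraph \<Rightarrow> bool" where
  "signed_graph G \<longleftrightarrow> finite (verts G) \<and> finite (edges G) \<and>
     (\<forall>e\<in>edges G. ends G e \<subseteq> verts G \<and> (card (ends G e) = 1 \<or> card (ends G e) = 2))"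

definition no_isolated_vertex :: "('v, 'e) sgraph \<Rightarrow> bool" where
  "no_isolated_vertex G \<longleftrightarrow> (\<forall>v\<in>verts G. \<exists>e\<in>edges G. v \<in> ends G e)"

text \<open>A loop meets its vertex twice, so its sign is multiplied twice by \<open>-\<close> and stays the same.\<close>

definition switch :: "'v \<Rightarrow> ('v, 'e) sgraph \<Rightarrow> ('v, 'e) sgraph" where
  "switch v G = G\<lparr>signature := (\<lambda>e. if v \<in> ends G e \<and> ends G e \<noteq> {v}
                                  then flip_sign (signature G e) else signature G e)\<rparr>"

definition switching_equivalent :: "('v, 'e) sgraph \<Rightarrow> ('v, 'e) sgraph \<Rightarrow> bool" where
  "switching_equivalent = (\<lambda>G H. \<exists>v\<in>verts G. H = switch v G)\<^sup>*\<^sup>*"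

definition negative_edges :: "('v, 'e) sgraph \<Rightarrow> 'e set" where
  "negative_edges G = {e \<in> edges G. signature G e = Negative}"

definition frustration_index :: "('v, 'e) sgraph \<Rightarrow> nat" where
  "frustration_index G = (LEAST n. \<exists>H. switching_equivalent G H \<and> card (negative_edges H) = n)"

definition delete_edge :: "('v, 'e) sgraph \<Rightarrow> 'e \<Rightarrow> ('v, 'e) sgraph" where
  "delete_edge G e = G\<lparr>edges := edges G - {e}\<rparr>"

definition critically_frustrated :: "nat \<Rightarrow> ('v, 'e) sgraph \<Rightarrow> bool" where
  "critically_frustrated k G \<longleftrightarrow> frustration_index G = k \<and>
     (\<forall>e\<in>edges G. frustration_index (delete_edge G e) + 1 = k)"

text \<open>\<open>S\<close> need not contain all the edges of sign \<open>s\<close> between \<open>x\<close> and \<open>y\<close>.\<close>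

definition multiedge :: "('v, 'e) sgraph \<Rightarrow> edge_sign \<Rightarrow> 'v \<Rightarrow> 'v \<Rightarrow> 'e set \<Rightarrow> bool" where
  "multiedge G s x y S \<longleftrightarrow> S \<noteq> {} \<and> S \<subseteq> edges G \<and> x \<noteq> y \<and>
     (\<forall>e\<in>S. ends G e = {x, y} \<and> signature G e = s)"

text \<open>\<open>G\<close> arises from \<open>H\<close> by subdividing at the multiedge \<open>S\<close>, with an arbitrary choice of names for
  the new vertex \<open>w\<close> and for the new edges \<open>A\<close> and \<open>B\<close> (names of deleted edges may be reused).\<close>

definition subdivision_step :: "('v, 'e) sgraph \<Rightarrow> ('v, 'e) sgraph \<Rightarrow> bool" where
  "subdivision_step H G \<longleftrightarrow> (\<exists>s x y S w A B.
     multiedge H s x y S \<and> w \<notin> verts H \<and>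
     verts G = insert w (verts H) \<and>
     edges G = (edges H - S) \<union> A \<union> B \<and>
     A \<inter> B = {} \<and> (A \<union> B) \<inter> (edges H - S) = {} \<and>
     card A = card S \<and> card B = card S \<and>
     multiedge G s x w A \<and> multiedge G Positive w y B \<and>
     (\<forall>e\<in>edges H - S. ends G e = ends H e \<and> signature G e = signature H e))"

definition proper_subdivision :: "('v, 'e) sgraph \<Rightarrow> ('v, 'e) sgraph \<Rightarrow> bool" where
  "proper_subdivision = subdivision_step\<^sup>+\<^sup>+"

text \<open>As usual for signed graphs, switching-equivalent signatures are not distinguished: \<open>G\<close> also
  counts as reducible when only some switching of it is a proper subdivision. Otherwise the
  all-negative odd cycles, which are switching equivalent to subdivisions of shorter negative
  cycles, would be irreducible.\<close>

definition irreducible_sgraph :: "('v, 'e) sgraph \<Rightarrow> bool" where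
  "irreducible_sgraph G \<longleftrightarrow>
     \<not> (\<exists>G' H. switching_equivalent G G' \<and> signed_graph H \<and> proper_subdivision H G')"

text \<open>Isolated vertices do not affect frustration or criticality. They are excluded, since adding
  them to a single member would already make the family infinite.\<close>

definition \<L> :: "nat \<Rightarrow> ('v, 'e) sgraph set" where
  "\<L> k = {G. signed_graph G \<and> no_isolated_vertex G \<and>
            critically_frustrated k G \<and> irreducible_sgraph G}"

definition sign_isomorphic :: "('v, 'e) sgraph \<Rightarrow> ('v, 'e) sgraph \<Rightarrow> bool" where
  "sign_isomorphic G H \<longleftrightarrow> (\<exists>f g. bij_betw f (verts G) (verts H) \<and> bij_betw g (edges G) (edges H) \<and>
     (\<forall>e\<in>edges G. ends H (g e) = f ` ends G e \<and> signature H (g e) = signature G e))"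

text \<open>Isomorphism, likewise up to switching. This is coarser than \<^const>\<open>sign_isomorphic\<close>, so
  infinitely many classes here give infinitely many classes there.\<close>

definition sgraph_isomorphism :: "(('v, 'e) sgraph \<times> ('v, 'e) sgraph) set" where
  "sgraph_isomorphism = {(G, H). \<exists>G'. switching_equivalent G G' \<and> sign_isomorphic G' H}"

end

theory Submission
  imports Defs
begin

text \<open>The antiprism over an \<open>m\<close>-gon is the square of a cycle of length \<open>2 * m\<close>. Its edges split into
  three cycles: the zigzag cycle of steps by 1 and the two \<open>m\<close>-gons formed by the steps by 2. Make all
  three cycles negative by giving the edges that wrap around past vertex 0 the sign \<open>-\<close>. The three
  edge-disjoint negative cycles force frustration index at least 3. Switching the initial segment
  \<open>{..<j}\<close> moves the negative edges to the three edges that pass over \<open>j\<close>, so that every edge lies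
  in a set of three negative edges and the graph is critical. A vertex created by a subdivision has at
  most two neighbours, while every vertex of the antiprism has four.\<close>

section \<open>Switching along cuts\<close>

text \<open>A loop has a singleton set of ends and so is in no cut, in agreement with
  \<open>switch\<close>, which leaves the signs of loops alone.\<close>

definition edge_cut :: "('v, 'e) sgraph \<Rightarrow> 'v set \<Rightarrow> 'e set" where
  "edge_cut G X = {e \<in> edges G. ends G e \<inter> X \<noteq> {} \<and> \<not> ends G e \<subseteq> X}"

lemma switch_simps [simp]:
  "verts (switch v G) = verts G" "edges (switch v G) = edges G" "ends (switch v G) = ends G"
  by (simp_all add: switch_def)

lemma signed_graph_delete_edge: "signed_graph G \<Longrightarrow> signed_graph (delete_edge G e)"
  by (simp add: signed_graph_def delete_edge_def)

lemma edge_cut_delete_edge: "edge_cut (delete_edge G e) X = edge_cut G X - {e}"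
  by (auto simp: edge_cut_def delete_edge_def)

lemma negative_edges_delete_edge: "negative_edges (delete_edge G e) = negative_edges G - {e}"
  by (auto simp: negative_edges_def delete_edge_def)

lemma flip_sign_eq_Negative: "flip_sign s = Negative \<longleftrightarrow> s \<noteq> Negative"
  by (cases s) auto

lemma signed_graph_endsE:
  assumes "signed_graph G" "e \<in> edges G"
  obtains u v where "ends G e = {u, v}" "u \<in> verts G" "v \<in> verts G"
proof -
  have "ends G e \<subseteq> verts G" "card (ends G e) = 1 \<or> card (ends G e) = 2"
    using assms by (auto simp: signed_graph_def)
  then show thesis
    using that by (fastforce simp: card_1_singleton_iff card_2_iff)
qed

lemma negative_edges_switch:
  assumes "signed_graph G"
  shows "negative_edges (switch v G) = sym_diff (negative_edges G) (edge_cut G {v})"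
proof -
  have "e \<in> negative_edges (switch v G) \<longleftrightarrow> e \<in> sym_diff (negative_edges G) (edge_cut G {v})"
    if e: "e \<in> edges G" for e
  proof -
    obtain a b where "ends G e = {a, b}" using assms e by (rule signed_graph_endsE)
    then show ?thesis using e
      by (auto simp: negative_edges_def edge_cut_def switch_def flip_sign_eq_Negative)
  qed
  then show ?thesis
    by (auto simp: negative_edges_def edge_cut_def)
qed

text \<open>An edge with ends \<open>a\<close>, \<open>b\<close> is cut iff exactly one of them is
  in the set, a parity condition, so cuts add modulo 2.\<close>

lemma edge_cut_sym_diff_singleton:
  assumes "signed_graph G"
  shows "edge_cut G (sym_diff X {v}) = sym_diff (edge_cut G X) (edge_cut G {v})"
proof -
  have "e \<in> edge_cut G (sym_diff X {v}) \<longleftrightarrow> e \<in> sym_diff (edge_cut G X) (edge_cut G {v})"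
    if e: "e \<in> edges G" for e
  proof -
    obtain a b where "ends G e = {a, b}" using assms e by (rule signed_graph_endsE)
    then show ?thesis using e by (auto simp: edge_cut_def)
  qed
  moreover have "edge_cut G Y \<subseteq> edges G" for Y by (auto simp: edge_cut_def)
  ultimately show ?thesis by blast
qed

text \<open>Two switchings at the same vertex cancel, so \<open>X\<close> collects the vertices
  switched an odd number of times.\<close>

lemma switching_equivalent_cut:
  assumes "switching_equivalent G H" "signed_graph G"
  shows "verts H = verts G \<and> edges H = edges G \<and> ends H = ends G \<and>
    (\<exists>X \<subseteq> verts G. negative_edges H = sym_diff (negative_edges G) (edge_cut G X))"
  using assms(1) unfolding switching_equivalent_def
proof (induction rule: rtranclp_induct)
  case base
  have "negative_edges G = sym_diff (negative_edges G) (edge_cut G {})"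
    by (auto simp: edge_cut_def)
  then show ?case by blast
next
  case (step H K)
  then obtain v where v: "v \<in> verts G" "K = switch v H" by auto
  from step.IH obtain X where X: "X \<subseteq> verts G"
    "negative_edges H = sym_diff (negative_edges G) (edge_cut G X)" by blast
  have "signed_graph H" "edge_cut H {v} = edge_cut G {v}"
    using step.IH assms(2) by (auto simp: signed_graph_def edge_cut_def)
  then have "negative_edges K = sym_diff (negative_edges G) (edge_cut G (sym_diff X {v}))"
    using X(2) v(2) by (auto simp: negative_edges_switch edge_cut_sym_diff_singleton[OF assms(2)])
  moreover have "sym_diff X {v} \<subseteq> verts G" using X(1) v(1) by auto
  ultimately show ?case using step.IH v(2) by (metis switch_simps)
qed

text \<open>The converse direction: switch once at each vertex of \<open>X\<close>. Minimising over
  switchings thus becomes minimising over vertex sets.\<close>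

lemma cut_switching_equivalent:
  assumes "signed_graph G" "X \<subseteq> verts G"
  shows "\<exists>H. switching_equivalent G H \<and> negative_edges H = sym_diff (negative_edges G) (edge_cut G X)"
proof -
  have "finite X" using assms by (auto simp: signed_graph_def intro: finite_subset)
  then show ?thesis using assms(2)
  proof (induction X)
    case empty
    have "switching_equivalent G G" by (simp add: switching_equivalent_def)
    moreover have "negative_edges G = sym_diff (negative_edges G) (edge_cut G {})"
      by (auto simp: edge_cut_def)
    ultimately show ?case by blast
  next
    case (insert v X)
    then obtain H where H: "switching_equivalent G H"
      "negative_edges H = sym_diff (negative_edges G) (edge_cut G X)" by auto
    have same: "verts H = verts G" "edges H = edges G" "ends H = ends G"
      using switching_equivalent_cut[OF H(1) assms(1)] by auto
    have "signed_graph H" "edge_cut H {v} = edge_cut G {v}"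
      using same assms(1) by (auto simp: signed_graph_def edge_cut_def)
    moreover have "insert v X = sym_diff X {v}" using insert.hyps by auto
    ultimately have "negative_edges (switch v H) = sym_diff (negative_edges G) (edge_cut G (insert v X))"
      using H(2) by (auto simp: negative_edges_switch edge_cut_sym_diff_singleton[OF assms(1)])
    moreover have "switching_equivalent G (switch v H)"
      using H(1) insert.prems same unfolding switching_equivalent_def
      by (auto intro: rtranclp.rtrancl_into_rtrancl)
    ultimately show ?case by blast
  qed
qed

section \<open>Frustration index and criticality in terms of cuts\<close>

lemma frustration_index_eqI:
  assumes "signed_graph G"
    and "\<And>X. X \<subseteq> verts G \<Longrightarrow> k \<le> card (sym_diff (negative_edges G) (edge_cut G X))"
    and "X \<subseteq> verts G" "card (sym_diff (negative_edges G) (edge_cut G X)) \<le> k"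
  shows "frustration_index G = k"
  unfolding frustration_index_def
proof (rule Least_equality)
  obtain H where "switching_equivalent G H" "negative_edges H = sym_diff (negative_edges G) (edge_cut G X)"
    using cut_switching_equivalent[OF assms(1,3)] by blast
  then show "\<exists>H. switching_equivalent G H \<and> card (negative_edges H) = k"
    using assms(2)[OF assms(3)] assms(4) by (metis le_antisym)
next
  fix n assume "\<exists>H. switching_equivalent G H \<and> card (negative_edges H) = n"
  then show "k \<le> n" using switching_equivalent_cut[OF _ assms(1)] assms(2) by metis
qed

text \<open>Deleting \<open>e\<close> only removes \<open>e\<close> from each candidate set of
  negative edges. Hence the lower bound drops by at most one, and a smallest set that contains
  \<open>e\<close> attains \<open>k - 1\<close>.\<close>

lemma critically_frustratedI:
  assumes G: "signed_graph G" and "edges G \<noteq> {}"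
    and lower: "\<And>X. X \<subseteq> verts G \<Longrightarrow> k \<le> card (sym_diff (negative_edges G) (edge_cut G X))"
    and upper: "\<And>e. e \<in> edges G \<Longrightarrow> \<exists>X \<subseteq> verts G. e \<in> sym_diff (negative_edges G) (edge_cut G X) \<and>
      card (sym_diff (negative_edges G) (edge_cut G X)) \<le> k"
  shows "critically_frustrated k G"
  unfolding critically_frustrated_def
proof (intro conjI ballI)
  show "frustration_index G = k"
    using assms(2) upper frustration_index_eqI[OF G lower] by blast
next
  fix e assume e: "e \<in> edges G"
  let ?N = "\<lambda>X. sym_diff (negative_edges G) (edge_cut G X)"
  have N: "sym_diff (negative_edges (delete_edge G e)) (edge_cut (delete_edge G e) X) = ?N X - {e}" for X
    by (auto simp: negative_edges_delete_edge edge_cut_delete_edge)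
  have verts: "verts (delete_edge G e) = verts G" by (simp add: delete_edge_def)
  have fin: "finite (?N X)" for X
    using G by (auto simp: signed_graph_def negative_edges_def edge_cut_def)
  obtain X where X: "X \<subseteq> verts G" "e \<in> ?N X" "card (?N X) \<le> k" using upper[OF e] by blast
  \<comment> \<open>Subtraction on naturals truncates, so \<open>k - 1 + 1 = k\<close> requires a
    positive \<open>k\<close>; the nonempty set for \<open>X\<close> provides it.\<close>
  have "k > 0"
    using X(2) lower[OF X(1)] X(3) fin[of X] by (metis card_gt_0_iff empty_iff le_antisym)
  have "frustration_index (delete_edge G e) = k - 1"
  proof (rule frustration_index_eqI[OF signed_graph_delete_edge[OF G]])
    fix Y assume "Y \<subseteq> verts (delete_edge G e)"
    then have "k \<le> card (?N Y)" using lower verts by simp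
    then have "k - 1 \<le> card (?N Y - {e})"
      using diff_card_le_card_Diff[of "{e}" "?N Y"] by simp
    then show "k - 1 \<le> card (sym_diff (negative_edges (delete_edge G e)) (edge_cut (delete_edge G e) Y))"
      by (simp only: N)
  next
    show "X \<subseteq> verts (delete_edge G e)" using X(1) verts by simp
    have "card (?N X - {e}) \<le> k - 1" using X(2,3) by (simp add: card_Diff_singleton_if)
    then show "card (sym_diff (negative_edges (delete_edge G e)) (edge_cut (delete_edge G e) X)) \<le> k - 1"
      by (simp only: N)
  qed
  then show "frustration_index (delete_edge G e) + 1 = k" using \<open>k > 0\<close> by simp
qed

text \<open>A closed walk with one negative edge keeps a negative edge under every switching.
  Otherwise no positive edge would cross \<open>X\<close>, all \<open>c k\<close> would lie on the
  same side, and the closing edge \<open>g l\<close> would stay negative.\<close>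

lemma negative_cycle_sym_diff_cut:
  assumes "\<And>k. k < l \<Longrightarrow> g k \<in> edges G \<and> ends G (g k) = {c k, c (Suc k)} \<and> signature G (g k) = Positive"
    and "g l \<in> edges G" "ends G (g l) = {c l, c 0}" "signature G (g l) = Negative"
  shows "\<exists>k \<le> l. g k \<in> sym_diff (negative_edges G) (edge_cut G X)"
proof (rule ccontr)
  assume "\<not> ?thesis"
  then have none: "g k \<in> negative_edges G \<longleftrightarrow> g k \<in> edge_cut G X" if "k \<le> l" for k
    using that by blast
  have "c k \<in> X \<longleftrightarrow> c 0 \<in> X" if "k \<le> l" for k
    using that
  proof (induction k)
    case (Suc k)
    then have k: "g k \<in> edges G" "ends G (g k) = {c k, c (Suc k)}" "signature G (g k) = Positive"
      using assms(1)[of k] by simp_all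
    have "g k \<notin> edge_cut G X"
      using none[of k] k(3) Suc.prems by (simp add: negative_edges_def)
    then have "c k \<in> X \<longleftrightarrow> c (Suc k) \<in> X"
      using k(1,2) by (auto simp: edge_cut_def)
    then show ?case using Suc by simp
  qed simp
  then have "c l \<in> X \<longleftrightarrow> c 0 \<in> X" by blast
  then have "g l \<notin> edge_cut G X" by (simp add: edge_cut_def assms(3))
  then show False using none[of l] assms(2,4) by (simp add: negative_edges_def)
qed

section \<open>Irreducibility\<close>

text \<open>An invariant for the intermediate graphs of a subdivision: it guarantees that the fresh
  vertex of the next step is an end of no old edge.\<close>

lemma subdivision_step_ends_subset:
  assumes "subdivision_step H G" "\<forall>e\<in>edges H. ends H e \<subseteq> verts H"
  shows "\<forall>e\<in>edges G. ends G e \<subseteq> verts G"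
proof -
  from assms(1) obtain s x y S w A B where *: "multiedge H s x y S"
    "verts G = insert w (verts H)" "edges G = (edges H - S) \<union> A \<union> B"
    "multiedge G s x w A" "multiedge G Positive w y B"
    "\<forall>e\<in>edges H - S. ends G e = ends H e \<and> signature G e = signature H e"
    unfolding subdivision_step_def by blast
  obtain f where "f \<in> S" using *(1) by (auto simp: multiedge_def)
  then have "f \<in> edges H" "ends H f = {x, y}" using *(1) by (auto simp: multiedge_def)
  then have "x \<in> verts H" "y \<in> verts H" using assms(2) by auto
  then have "ends G e \<subseteq> verts G" if "e \<in> A \<or> e \<in> B" for e
    using that *(2,4,5) by (auto simp: multiedge_def)
  moreover have "ends G e \<subseteq> verts G" if "e \<in> edges H - S" for e
    using that *(2,6) assms(2) by auto
  ultimately show ?thesis using *(3) by blast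
qed

lemma subdivision_step_two_neighbours:
  assumes "subdivision_step H G" "\<forall>e\<in>edges H. ends H e \<subseteq> verts H"
  shows "\<exists>w\<in>verts G. \<exists>x y. \<forall>e\<in>edges G. w \<in> ends G e \<longrightarrow> ends G e = {w, x} \<or> ends G e = {w, y}"
proof -
  from assms(1) obtain s x y S w A B where *: "w \<notin> verts H"
    "verts G = insert w (verts H)" "edges G = (edges H - S) \<union> A \<union> B"
    "multiedge G s x w A" "multiedge G Positive w y B"
    "\<forall>e\<in>edges H - S. ends G e = ends H e \<and> signature G e = signature H e"
    unfolding subdivision_step_def by blast
  have "ends G e = {w, x} \<or> ends G e = {w, y}" if "e \<in> edges G" "w \<in> ends G e" for e
  proof -
    \<comment> \<open>Retained edges have both ends in \<open>verts H\<close>, which misses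
      \<open>w\<close>.\<close>
    have "e \<notin> edges H - S" using that(2) *(1,6) assms(2) by auto
    then have "e \<in> A \<or> e \<in> B" using that(1) *(3) by auto
    then show ?thesis using *(4,5) unfolding multiedge_def by (metis insert_commute)
  qed
  then show ?thesis using *(2) by blast
qed

lemma proper_subdivision_two_neighbours:
  assumes "proper_subdivision H G" "signed_graph H"
  shows "\<exists>w\<in>verts G. \<exists>x y. \<forall>e\<in>edges G. w \<in> ends G e \<longrightarrow> ends G e = {w, x} \<or> ends G e = {w, y}"
proof -
  \<comment> \<open>The vertex from the last step is the right one: an earlier new vertex can gain
    neighbours when only some of its parallel edges are subdivided later.\<close>
  from assms(1) obtain K where K: "subdivision_step\<^sup>*\<^sup>* H K" "subdivision_step K G"
    unfolding proper_subdivision_def by (blast elim: tranclp.cases intro: tranclp_into_rtranclp rtranclp.rtrancl_refl)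
  from K(1) have "\<forall>e\<in>edges K. ends K e \<subseteq> verts K"
  proof (induction rule: rtranclp_induct)
    case base
    show ?case using assms(2) by (simp add: signed_graph_def)
  next
    case (step K L)
    then show ?case using subdivision_step_ends_subset by blast
  qed
  with K(2) show ?thesis by (rule subdivision_step_two_neighbours)
qed

text \<open>Switching changes no ends, so a graph in which each vertex has at least three neighbours
  has no switching with a vertex of the kind that a subdivision leaves behind.\<close>

lemma irreducible_sgraphI:
  assumes "signed_graph G"
    and "\<And>w x y. w \<in> verts G \<Longrightarrow> \<exists>e\<in>edges G. w \<in> ends G e \<and> ends G e \<noteq> {w, x} \<and> ends G e \<noteq> {w, y}"
  shows "irreducible_sgraph G"
  unfolding irreducible_sgraph_def
proof
  assume "\<exists>G' H. switching_equivalent G G' \<and> signed_graph H \<and> proper_subdivision H G'"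
  then obtain G' H where *: "switching_equivalent G G'" "signed_graph H" "proper_subdivision H G'"
    by blast
  have same: "verts G' = verts G" "edges G' = edges G" "ends G' = ends G"
    using switching_equivalent_cut[OF *(1) assms(1)] by auto
  from proper_subdivision_two_neighbours[OF *(3,2)] show False
    unfolding same using assms(2) by meson
qed

section \<open>Negative antiprisms\<close>

text \<open>Edge \<open>i < 2 * m\<close> is the step by 1 from vertex \<open>i\<close>, and edge \<open>2 * m + i\<close> the step by 2 from it.\<close>

definition antiprism :: "nat \<Rightarrow> (nat, nat) sgraph" where
  "antiprism m = \<lparr>verts = {..<2 * m}, edges = {..<4 * m},
     ends = (\<lambda>e. if e < 2 * m then {e, (e + 1) mod (2 * m)}
                 else {e - 2 * m, (e - 2 * m + 2) mod (2 * m)}),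
     signature = (\<lambda>e. if e \<in> {2 * m - 1, 4 * m - 2, 4 * m - 1} then Negative else Positive)\<rparr>"

lemma antiprism_simps [simp]:
  "verts (antiprism m) = {..<2 * m}" "edges (antiprism m) = {..<4 * m}"
  by (simp_all add: antiprism_def)

lemma mod_eq_if_less_double: "a < 2 * n \<Longrightarrow> a mod n = (if a < n then a else a - n)" for a n :: nat
  by (simp add: le_mod_geq)

text \<open>Conditionals replace \<open>mod\<close>, so that later case distinctions end in linear
  arithmetic.\<close>

lemma ends_antiprism:
  assumes "m \<ge> 3" "i < 2 * m"
  shows "ends (antiprism m) i = {i, if i + 1 < 2 * m then i + 1 else 0}"
    and "ends (antiprism m) (2 * m + i) = {i, if i + 2 < 2 * m then i + 2 else i + 2 - 2 * m}"
  using assms by (simp_all add: antiprism_def mod_eq_if_less_double)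

lemma antiprism_edge_cases:
  assumes "e \<in> edges (antiprism m)"
  obtains i where "i < 2 * m" "e = i \<or> e = 2 * m + i"
proof (cases "e < 2 * m")
  case True
  then show ?thesis by (rule that) simp
next
  case False
  then show ?thesis using that[of "e - 2 * m"] assms by simp
qed

lemma card_doubleton_cases: "card {a, b} = 1 \<or> card {a, b} = 2"
  by (cases "a = b") auto

lemma signed_graph_antiprism:
  assumes "m \<ge> 3"
  shows "signed_graph (antiprism m)"
  unfolding signed_graph_def
proof (intro conjI ballI)
  fix e assume "e \<in> edges (antiprism m)"
  then obtain i where i: "i < 2 * m" "e = i \<or> e = 2 * m + i" by (rule antiprism_edge_cases)
  show "ends (antiprism m) e \<subseteq> verts (antiprism m)"
    using i assms by (auto simp: ends_antiprism split: if_splits)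
  show "card (ends (antiprism m) e) = 1 \<or> card (ends (antiprism m) e) = 2"
    using i assms by (metis ends_antiprism card_doubleton_cases)
qed simp_all

lemma no_isolated_vertex_antiprism:
  assumes "m \<ge> 3"
  shows "no_isolated_vertex (antiprism m)"
  unfolding no_isolated_vertex_def
proof
  fix v assume "v \<in> verts (antiprism m)"
  then have "v \<in> edges (antiprism m)" "v \<in> ends (antiprism m) v"
    using assms by (simp_all add: ends_antiprism)
  then show "\<exists>e\<in>edges (antiprism m). v \<in> ends (antiprism m) e" by blast
qed

section \<open>Frustration, criticality and irreducibility of the antiprisms\<close>

lemma frustration_antiprism_ge:
  assumes "m \<ge> 3"
  shows "3 \<le> card (sym_diff (negative_edges (antiprism m)) (edge_cut (antiprism m) X))"
    (is "3 \<le> card ?N")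
proof -
  \<comment> \<open>The zigzag cycle, closed by the negative edge \<open>2 * m - 1\<close>.\<close>
  have "\<exists>k \<le> 2 * m - 1. k \<in> ?N"
    by (rule negative_cycle_sym_diff_cut[where c = "\<lambda>k. k" and g = "\<lambda>k. k"])
      (use assms in \<open>auto simp: ends_antiprism\<close>, auto simp: antiprism_def)
  then obtain a where a: "a \<in> ?N" "a < 2 * m" using assms by force
  \<comment> \<open>The polygon on the even vertices, closed by the negative edge
    \<open>4 * m - 2\<close>; the odd one below is closed by \<open>4 * m - 1\<close>.\<close>
  have "\<exists>k \<le> m - 1. 2 * m + 2 * k \<in> ?N"
    by (rule negative_cycle_sym_diff_cut[where c = "\<lambda>k. 2 * k"])
      (use assms in \<open>auto simp: ends_antiprism\<close>, auto simp: antiprism_def)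
  then obtain b where b: "2 * m + 2 * b \<in> ?N" by blast
  have "\<exists>k \<le> m - 1. 2 * m + (2 * k + 1) \<in> ?N"
    by (rule negative_cycle_sym_diff_cut[where c = "\<lambda>k. 2 * k + 1"])
      (use assms in \<open>auto simp only: ends_antiprism\<close>, auto simp: antiprism_def)
  then obtain c where c: "2 * m + (2 * c + 1) \<in> ?N" by blast
  \<comment> \<open>The first edge is below \<open>2 * m\<close>, and the other two differ in
    parity.\<close>
  have "card {a, 2 * m + 2 * b, 2 * m + (2 * c + 1)} = 3"
    using a(2) by (auto simp: card_insert_if) presburger
  moreover have "{a, 2 * m + 2 * b, 2 * m + (2 * c + 1)} \<subseteq> ?N" using a(1) b c by blast
  moreover have "finite ?N" by (auto simp: negative_edges_def edge_cut_def)
  ultimately show ?thesis by (metis card_mono)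
qed

text \<open>For \<open>j > 0\<close> the set \<open>{..<j}\<close> has two boundary gaps on the
  cycle, one before 0 and one between \<open>i\<close> and \<open>j\<close>. The initial negative
  signs cancel the crossings of the first gap, leaving the three edges that span the second. For
  \<open>j = 0\<close> the cut is empty, and the initial negative edges are those spanning the gap
  between \<open>2 * m - 1\<close> and 0.\<close>

lemma sym_diff_cut_lessThan_antiprism:
  assumes "m \<ge> 3" "i < 2 * m" and j: "j = (if i + 1 < 2 * m then i + 1 else 0)"
  shows "sym_diff (negative_edges (antiprism m)) (edge_cut (antiprism m) {..<j}) =
    {i, 2 * m + i, 2 * m + (if i = 0 then 2 * m - 1 else i - 1)}" (is "?N = ?R")
proof -
  have "e \<in> ?N \<longleftrightarrow> e \<in> ?R" if e: "e \<in> edges (antiprism m)" for e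
  proof -
    obtain k where k: "k < 2 * m" "e = k \<or> e = 2 * m + k"
      using e by (rule antiprism_edge_cases)
    have neg: "e \<in> negative_edges (antiprism m) \<longleftrightarrow> e \<in> {2 * m - 1, 4 * m - 2, 4 * m - 1}"
      using e by (auto simp: negative_edges_def antiprism_def)
    from k(2) show ?thesis
    proof
      assume ek: "e = k"
      have "e \<in> edge_cut (antiprism m) {..<j} \<longleftrightarrow>
          (k < j) \<noteq> ((if k + 1 < 2 * m then k + 1 else 0) < j)"
        using e ek k(1) assms(1) by (auto simp: edge_cut_def ends_antiprism)
      moreover have "e \<in> negative_edges (antiprism m) \<longleftrightarrow> k = 2 * m - 1"
        using neg ek k(1) by auto
      moreover have "e \<in> ?R \<longleftrightarrow> k = i"
        using ek k(1) by auto
      moreover have "(k = 2 * m - 1) \<noteq> ((k < j) \<noteq> ((if k + 1 < 2 * m then k + 1 else 0) < j)) \<longleftrightarrow> k = i"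
        using assms k(1) by (cases "i + 1 < 2 * m"; cases "k + 1 < 2 * m"; auto)
      ultimately show ?thesis by blast
    next
      assume ek: "e = 2 * m + k"
      have "e \<in> edge_cut (antiprism m) {..<j} \<longleftrightarrow>
          (k < j) \<noteq> ((if k + 2 < 2 * m then k + 2 else k + 2 - 2 * m) < j)"
        using e ek k(1) assms(1) by (auto simp: edge_cut_def ends_antiprism)
      moreover have "e \<in> negative_edges (antiprism m) \<longleftrightarrow> k \<ge> 2 * m - 2"
        using neg ek k(1) by auto
      moreover have "e \<in> ?R \<longleftrightarrow> k = i \<or> k = (if i = 0 then 2 * m - 1 else i - 1)"
        using ek assms(2) by auto
      moreover have "(k \<ge> 2 * m - 2) \<noteq>
          ((k < j) \<noteq> ((if k + 2 < 2 * m then k + 2 else k + 2 - 2 * m) < j)) \<longleftrightarrow>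
          k = i \<or> k = (if i = 0 then 2 * m - 1 else i - 1)"
        using assms k(1) by (cases "i + 1 < 2 * m"; cases "k + 2 < 2 * m"; cases "i = 0"; auto)
      ultimately show ?thesis by blast
    qed
  qed
  moreover have "?N \<subseteq> edges (antiprism m)" by (auto simp: negative_edges_def edge_cut_def)
  moreover have "?R \<subseteq> edges (antiprism m)" using assms by auto
  ultimately show ?thesis by blast
qed

lemma critically_frustrated_antiprism:
  assumes "m \<ge> 3"
  shows "critically_frustrated 3 (antiprism m)"
proof (rule critically_frustratedI[OF signed_graph_antiprism[OF assms]])
  have "0 \<in> edges (antiprism m)" using assms by simp
  then show "edges (antiprism m) \<noteq> {}" by blast
next
  fix e assume "e \<in> edges (antiprism m)"
  then obtain i where i: "i < 2 * m" "e = i \<or> e = 2 * m + i" by (rule antiprism_edge_cases)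
  \<comment> \<open>The gap just after \<open>i\<close> is spanned both by the step by 1 and by the
    step by 2 from \<open>i\<close>, so one cut serves both forms of \<open>e\<close>.\<close>
  define j where "j = (if i + 1 < 2 * m then i + 1 else 0)"
  let ?N = "sym_diff (negative_edges (antiprism m)) (edge_cut (antiprism m) {..<j})"
  have N: "?N = {i, 2 * m + i, 2 * m + (if i = 0 then 2 * m - 1 else i - 1)}"
    using assms i(1) j_def by (rule sym_diff_cut_lessThan_antiprism)
  have "e \<in> ?N" unfolding N using i(2) by blast
  moreover have "card ?N \<le> 3" unfolding N by (simp add: card_insert_if)
  moreover have "{..<j} \<subseteq> verts (antiprism m)" by (auto simp: j_def split: if_splits)
  ultimately show "\<exists>X\<subseteq>verts (antiprism m).
      e \<in> sym_diff (negative_edges (antiprism m)) (edge_cut (antiprism m) X) \<and>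
      card (sym_diff (negative_edges (antiprism m)) (edge_cut (antiprism m) X)) \<le> 3"
    by blast
qed (rule frustration_antiprism_ge[OF assms])

lemma irreducible_antiprism:
  assumes "m \<ge> 3"
  shows "irreducible_sgraph (antiprism m)"
proof (rule irreducible_sgraphI[OF signed_graph_antiprism[OF assms]])
  fix w x y assume "w \<in> verts (antiprism m)"
  then have w: "w < 2 * m" by simp
  \<comment> \<open>The predecessor and the two successors of \<open>w\<close> are three distinct
    neighbours, and \<open>x\<close>, \<open>y\<close> can account for only two of them.\<close>
  define p where "p = (if w = 0 then 2 * m - 1 else w - 1)"
  define a where "a = (if w + 1 < 2 * m then w + 1 else 0)"
  define b where "b = (if w + 2 < 2 * m then w + 2 else w + 2 - 2 * m)"
  have ends: "ends (antiprism m) w = {w, a}" "ends (antiprism m) (2 * m + w) = {w, b}"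
    "ends (antiprism m) p = {w, p}"
    using assms w by (auto simp: ends_antiprism a_def b_def p_def)
  have "p < 2 * m" using w by (auto simp: p_def)
  then have edges: "{w, 2 * m + w, p} \<subseteq> edges (antiprism m)" using w by auto
  have "a \<noteq> b" "a \<noteq> p" "b \<noteq> p" using w assms by (auto simp: a_def b_def p_def split: if_splits)
  then obtain z where "z \<in> {a, b, p}" "z \<noteq> x" "z \<noteq> y" by auto
  then have "{w, z} \<noteq> {w, x}" "{w, z} \<noteq> {w, y}" by (auto simp: doubleton_eq_iff)
  moreover have "\<exists>e\<in>edges (antiprism m). ends (antiprism m) e = {w, z}"
    using \<open>z \<in> {a, b, p}\<close> ends edges by blast
  ultimately show "\<exists>e\<in>edges (antiprism m). w \<in> ends (antiprism m) e \<and>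
      ends (antiprism m) e \<noteq> {w, x} \<and> ends (antiprism m) e \<noteq> {w, y}"
    by (metis insertI1)
qed

lemma antiprism_in_\<L>: "m \<ge> 3 \<Longrightarrow> antiprism m \<in> \<L> 3"
  by (simp add: \<L>_def signed_graph_antiprism no_isolated_vertex_antiprism
      critically_frustrated_antiprism irreducible_antiprism)

section \<open>Isomorphism classes\<close>

lemma sgraph_isomorphism_refl: "(G, G) \<in> sgraph_isomorphism"
proof -
  have "switching_equivalent G G" by (simp add: switching_equivalent_def)
  moreover have "sign_isomorphic G G"
    unfolding sign_isomorphic_def by (rule exI[of _ id], rule exI[of _ id]) simp
  ultimately show ?thesis unfolding sgraph_isomorphism_def by blast
qed

text \<open>The invariant that separates the antiprisms, which have \<open>2 * m\<close>
  vertices.\<close>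

lemma sgraph_isomorphism_card_verts:
  assumes "(G, H) \<in> sgraph_isomorphism" "signed_graph G"
  shows "card (verts G) = card (verts H)"
proof -
  from assms(1) obtain G' where G': "switching_equivalent G G'" "sign_isomorphic G' H"
    unfolding sgraph_isomorphism_def by blast
  from G'(2) have "card (verts G') = card (verts H)"
    unfolding sign_isomorphic_def by (blast dest: bij_betw_same_card)
  then show ?thesis using switching_equivalent_cut[OF G'(1) assms(2)] by simp
qed

theorem mainTheorem14:
  shows "infinite ((\<L> 3 :: (nat, nat) sgraph set) // sgraph_isomorphism)"
proof -
  let ?c = "\<lambda>m. sgraph_isomorphism `` {antiprism m}"
  have "inj_on ?c {3..}"
  proof (rule inj_onI)
    fix m n :: nat assume "m \<in> {3..}" "n \<in> {3..}" "?c m = ?c n"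
    \<comment> \<open>Reflexivity places \<open>antiprism n\<close> in its own class, which equals
      that of \<open>antiprism m\<close>.\<close>
    then have "(antiprism m, antiprism n) \<in> sgraph_isomorphism"
      using sgraph_isomorphism_refl by blast
    moreover have "signed_graph (antiprism m)"
      using \<open>m \<in> {3..}\<close> by (simp add: signed_graph_antiprism)
    ultimately have "card (verts (antiprism m)) = card (verts (antiprism n))"
      by (rule sgraph_isomorphism_card_verts)
    then show "m = n" by simp
  qed
  then have "infinite (?c ` {3..})" using infinite_Ici finite_imageD by blast
  moreover have "?c ` {3..} \<subseteq> \<L> 3 // sgraph_isomorphism"
    using antiprism_in_\<L> by (auto intro: quotientI)
  ultimately show ?thesis by (rule infinite_super[rotated])
qed

end
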